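(* The tile number and the minimal mosaic tile number of the unknot are both equal to $4$: $t(\text{unknot})=t_M(\text{unknot})=4$.
   Context: Mosaic tiles: eleven unit squares. $T_0$ is blank. $T_1,T_2,T_3,T_4$ are single arc tiles: $T_1$ joins the midpoints of the left and bottom sides, $T_2$ bottom and right, $T_3$ right and top, $T_4$ top and left. $T_5$ is a horizontal segment tile (left to right), $T_6$ a vertical segment tile (top to bottom). $T_7,T_8$ are the two double arc tiles (one has left-bottom and top-right arcs, the other left-top and bottom-right arcs). $T_9,T_{10}$ are the two crossing tiles (a horizontal and a vertical strand crossing, one for each crossing type). Tiles other than $T_0$ are non-blank. A connection point of a tile is a midpoint of a tile edge that is also an endpoint of a curve drawn on the tile. A tile is suitably connected if each of its connection points touches a connection point of an adjacent tile. An $n$-mosaic is an $n\times n$ array of tiles each of which is suitably connected; it depicts a knot or link diagram. The mosaic number $m(K)$ of a knot or link $K$ is the smallest integer $n$ for which $K$ can be represented as an $n$-mosaic. The tile number of a mosaic is its number of non-blank tiles. The tile number $t(K)$ is the smallest tile number among all mosaics (of any size) representing $K$. The minimal mosaic tile number $t_M(K)$ is the smallest tile number among all $m(K)$-mosaics representing $K$. *)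

theory Defs
  imports "HOL-Analysis.Analysis"
begin

datatype tile = T0 | T1 | T2 | T3 | T4 | T5 | T6 | T7 | T8 | T9 | T10

datatype side = Left | Right | Top | Bottom

text \<open>
  A tile is the unit square \<open>[0,1] \<times> [0,1]\<close>. Its curves are drawn in space so that a mosaic determines
  a subset of \<open>\<real>\<^sup>3\<close> rather than a planar diagram: the diagram is the projection to the first two
  coordinates, and at a crossing the overstrand is the one whose third coordinate is positive.
\<close>

definition quarter_circle :: "real \<Rightarrow> real \<Rightarrow> (real^3) set" where
  "quarter_circle a b =
     {vector [u, v, 0] | u v. 0 \<le> u \<and> u \<le> 1 \<and> 0 \<le> v \<and> v \<le> 1 \<and> (u - a)\<^sup>2 + (v - b)\<^sup>2 = (1/2)\<^sup>2}"

text \<open>The strand has height 0 at its endpoints, and height \<open>h / 4\<close> over the centre of the tile.\<close>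

definition horizontal_strand :: "real \<Rightarrow> (real^3) set" where
  "horizontal_strand h = {vector [u, 1/2, h * u * (1 - u)] | u. 0 \<le> u \<and> u \<le> 1}"

definition vertical_strand :: "real \<Rightarrow> (real^3) set" where
  "vertical_strand h = {vector [1/2, v, h * v * (1 - v)] | v. 0 \<le> v \<and> v \<le> 1}"

fun tile_curves :: "tile \<Rightarrow> (real^3) set" where
  "tile_curves T0 = {}"
| "tile_curves T1 = quarter_circle 0 0"
| "tile_curves T2 = quarter_circle 1 0"
| "tile_curves T3 = quarter_circle 1 1"
| "tile_curves T4 = quarter_circle 0 1"
| "tile_curves T5 = horizontal_strand 0"
| "tile_curves T6 = vertical_strand 0"
| "tile_curves T7 = quarter_circle 0 0 \<union> quarter_circle 1 1"
| "tile_curves T8 = quarter_circle 0 1 \<union> quarter_circle 1 0"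
| "tile_curves T9 = horizontal_strand 1 \<union> vertical_strand 0"
| "tile_curves T10 = horizontal_strand 0 \<union> vertical_strand 1"

fun edge_midpoint :: "side \<Rightarrow> real^3" where
  "edge_midpoint Left = vector [0, 1/2, 0]"
| "edge_midpoint Right = vector [1, 1/2, 0]"
| "edge_midpoint Top = vector [1/2, 1, 0]"
| "edge_midpoint Bottom = vector [1/2, 0, 0]"

text \<open>
  The curves of a tile reach the boundary of the square only at their endpoints, so the edge
  midpoints lying on the curves are exactly those that are endpoints of a curve.
\<close>

definition connection_points :: "tile \<Rightarrow> side set" where
  "connection_points t = {s. edge_midpoint s \<in> tile_curves t}"

text \<open>
  The tile with indices \<open>x, y\<close> occupies the square \<open>[x, x+1] \<times> [y, y+1]\<close>, so that \<open>x\<close> is the column,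
  counted from the left, and \<open>y\<close> is the row, counted from the bottom.
\<close>

fun adjacent :: "side \<Rightarrow> nat \<times> nat \<Rightarrow> nat \<times> nat \<Rightarrow> bool" where
  "adjacent Left (x, y) (x', y') \<longleftrightarrow> x = x' + 1 \<and> y' = y"
| "adjacent Right (x, y) (x', y') \<longleftrightarrow> x' = x + 1 \<and> y' = y"
| "adjacent Top (x, y) (x', y') \<longleftrightarrow> x' = x \<and> y' = y + 1"
| "adjacent Bottom (x, y) (x', y') \<longleftrightarrow> x' = x \<and> y = y' + 1"

fun opposite :: "side \<Rightarrow> side" where
  "opposite Left = Right"
| "opposite Right = Left"
| "opposite Top = Bottom"
| "opposite Bottom = Top"

definition suitably_connected :: "nat \<Rightarrow> (nat \<Rightarrow> nat \<Rightarrow> tile) \<Rightarrow> nat \<Rightarrow> nat \<Rightarrow> bool" where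
  "suitably_connected n M x y \<longleftrightarrow>
     (\<forall>s \<in> connection_points (M x y). \<exists>x' < n. \<exists>y' < n.
        adjacent s (x, y) (x', y') \<and> opposite s \<in> connection_points (M x' y'))"

text \<open>Only the entries of \<open>M\<close> with both indices below \<open>n\<close> belong to the mosaic.\<close>

definition mosaic :: "nat \<Rightarrow> (nat \<Rightarrow> nat \<Rightarrow> tile) \<Rightarrow> bool" where
  "mosaic n M \<longleftrightarrow> 0 < n \<and> (\<forall>x < n. \<forall>y < n. suitably_connected n M x y)"

definition mosaic_tile_number :: "nat \<Rightarrow> (nat \<Rightarrow> nat \<Rightarrow> tile) \<Rightarrow> nat" where
  "mosaic_tile_number n M = card {(x, y). x < n \<and> y < n \<and> M x y \<noteq> T0}"

definition mosaic_link :: "nat \<Rightarrow> (nat \<Rightarrow> nat \<Rightarrow> tile) \<Rightarrow> (real^3) set" where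
  "mosaic_link n M =
     (\<Union>x<n. \<Union>y<n. (\<lambda>p. vector [real x, real y, 0] + p) ` tile_curves (M x y))"

definition ambient_isotopic :: "(real^3) set \<Rightarrow> (real^3) set \<Rightarrow> bool" where
  "ambient_isotopic K L \<longleftrightarrow>
     (\<exists>H :: real \<Rightarrow> real^3 \<Rightarrow> real^3.
        continuous_on ({0..1} \<times> UNIV) (\<lambda>(t, p). H t p) \<and>
        (\<forall>t \<in> {0..1}. \<exists>G. homeomorphism UNIV UNIV (H t) G) \<and>
        (\<forall>p. H 0 p = p) \<and>
        H 1 ` K = L)"

definition represents :: "nat \<Rightarrow> (nat \<Rightarrow> nat \<Rightarrow> tile) \<Rightarrow> (real^3) set \<Rightarrow> bool" where
  "represents n M K \<longleftrightarrow> mosaic n M \<and> ambient_isotopic (mosaic_link n M) K"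

definition mosaic_number :: "(real^3) set \<Rightarrow> nat" where
  "mosaic_number K = (LEAST n. \<exists>M. represents n M K)"

definition tile_number :: "(real^3) set \<Rightarrow> nat" where
  "tile_number K = (LEAST k. \<exists>n M. represents n M K \<and> mosaic_tile_number n M = k)"

definition minimal_mosaic_tile_number :: "(real^3) set \<Rightarrow> nat" where
  "minimal_mosaic_tile_number K =
     (LEAST k. \<exists>M. represents (mosaic_number K) M K \<and> mosaic_tile_number (mosaic_number K) M = k)"

definition standard_circle :: "(real^3) set" where
  "standard_circle = {vector [cos t, sin t, 0] | t. True}"

definition is_unknot :: "(real^3) set \<Rightarrow> bool" where
  "is_unknot K \<longleftrightarrow> ambient_isotopic standard_circle K"

lemma mem_quarter_circle:
  "vector [u, v, w] \<in> quarter_circle a b \<longleftrightarrow>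
     0 \<le> u \<and> u \<le> 1 \<and> 0 \<le> v \<and> v \<le> 1 \<and> w = 0 \<and> (u - a)\<^sup>2 + (v - b)\<^sup>2 = (1/2)\<^sup>2"
  by (auto simp: quarter_circle_def vec_eq_iff forall_3)

lemma mem_horizontal_strand:
  "vector [u, v, w] \<in> horizontal_strand h \<longleftrightarrow> 0 \<le> u \<and> u \<le> 1 \<and> v = 1/2 \<and> w = h * u * (1 - u)"
  by (auto simp: horizontal_strand_def vec_eq_iff forall_3)

lemma mem_vertical_strand:
  "vector [u, v, w] \<in> vertical_strand h \<longleftrightarrow> u = 1/2 \<and> 0 \<le> v \<and> v \<le> 1 \<and> w = h * v * (1 - v)"
  by (auto simp: vertical_strand_def vec_eq_iff forall_3)

lemma connection_points_simps [simp]: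
  "connection_points T0 = {}"
  "connection_points T1 = {Left, Bottom}"
  "connection_points T2 = {Bottom, Right}"
  "connection_points T3 = {Right, Top}"
  "connection_points T4 = {Top, Left}"
  "connection_points T5 = {Left, Right}"
  "connection_points T6 = {Top, Bottom}"
  "connection_points T7 = {Left, Bottom, Top, Right}"
  "connection_points T8 = {Left, Top, Bottom, Right}"
  "connection_points T9 = {Left, Right, Top, Bottom}"
  "connection_points T10 = {Left, Right, Top, Bottom}"
proof -
  have mem: "s \<in> connection_points t \<longleftrightarrow> edge_midpoint s \<in> tile_curves t" for s t
    by (simp add: connection_points_def)
  have eq: "A = B \<longleftrightarrow> (\<forall>s \<in> {Left, Right, Top, Bottom}. s \<in> A \<longleftrightarrow> s \<in> B)" for A B :: "side set"
  proof -
    have "P s" if "\<forall>s \<in> {Left, Right, Top, Bottom}. P s" for P s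
      using that by (cases s) auto
    then show ?thesis by blast
  qed
  note simps = eq mem mem_quarter_circle mem_horizontal_strand mem_vertical_strand power2_eq_square
  show
    "connection_points T0 = {}"
    "connection_points T1 = {Left, Bottom}"
    "connection_points T2 = {Bottom, Right}"
    "connection_points T3 = {Right, Top}"
    "connection_points T4 = {Top, Left}"
    "connection_points T5 = {Left, Right}"
    "connection_points T6 = {Top, Bottom}"
    "connection_points T7 = {Left, Bottom, Top, Right}"
    "connection_points T8 = {Left, Top, Bottom, Right}"
    "connection_points T9 = {Left, Right, Top, Bottom}"
    "connection_points T10 = {Left, Right, Top, Bottom}"
    by (simp_all add: simps)
qed

end

theory Submission imports Defs begin

text \<open>
  Four tiles suffice: the four single arc tiles, placed in a two by two array, draw the circle of
  radius \<open>1/2\<close> about \<open>(1, 1)\<close>, and a homothety is isotopic to the identity, so this circle is an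
  unknot (\<open>four_arcs_isotopic_standard_circle\<close>). Isotopies compose, so the array represents every
  unknot.

  Fewer tiles draw nothing at all (\<open>four_le_mosaic_tile_number\<close>). Every curve that enters a tile
  leaves it again. Hence the lowest tile of the leftmost occupied column, which cannot be
  entered from the left or from below, continues both upwards and to the right. So this column holds
  two tiles and is not the rightmost one; in the same way, the rightmost occupied column holds two tiles.
  As a knot is a nonempty set, its mosaics have at least four non-blank tiles.

  A one by one array has no room for four tiles, so the mosaic number of the unknot is 2. The array of
  four arcs therefore attains the minimum for both tile numbers.
\<close>

section \<open>A nonempty mosaic has four non-blank tiles\<close>

definition non_blank_positions :: "nat \<Rightarrow> (nat \<Rightarrow> nat \<Rightarrow> tile) \<Rightarrow> (nat \<times> nat) set" where
  "non_blank_positions n M = {(x, y). x < n \<and> y < n \<and> M x y \<noteq> T0}"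

lemma non_blank_positions_subset: "non_blank_positions n M \<subseteq> {..<n} \<times> {..<n}"
  by (auto simp: non_blank_positions_def)

lemma finite_non_blank_positions: "finite (non_blank_positions n M)"
  by (rule finite_subset[OF non_blank_positions_subset]) simp

lemma mosaic_tile_number_eq_card: "mosaic_tile_number n M = card (non_blank_positions n M)"
  by (simp add: mosaic_tile_number_def non_blank_positions_def)

lemma mosaic_tile_number_le_square: "mosaic_tile_number n M \<le> n * n"
  using card_mono[OF _ non_blank_positions_subset, of n M] by (simp add: mosaic_tile_number_eq_card)

lemma non_blank_neighbour:
  assumes "mosaic n M" "(x, y) \<in> non_blank_positions n M" "s \<in> connection_points (M x y)"
  obtains x' y' where "adjacent s (x, y) (x', y')" "(x', y') \<in> non_blank_positions n M"
proof -
  have "suitably_connected n M x y"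
    using assms(1,2) by (auto simp: mosaic_def non_blank_positions_def)
  then obtain x' y' where "x' < n" "y' < n" and adj: "adjacent s (x, y) (x', y')"
    and "opposite s \<in> connection_points (M x' y')"
    using assms(3) unfolding suitably_connected_def by blast
  then have "(x', y') \<in> non_blank_positions n M"
    by (auto simp: non_blank_positions_def)
  with adj show thesis by (rule that)
qed

text \<open>A curve has two endpoints, so a non-blank tile with none on two of its sides has one on each other side.\<close>

lemma top_right_if_not_left_bottom:
  assumes "t \<noteq> T0" "Left \<notin> connection_points t" "Bottom \<notin> connection_points t"
  shows "Top \<in> connection_points t" "Right \<in> connection_points t"
  using assms by (cases t; simp)+

lemma bottom_if_not_right_top:
  assumes "t \<noteq> T0" "Right \<notin> connection_points t" "Top \<notin> connection_points t"
  shows "Bottom \<in> connection_points t"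
  using assms by (cases t) simp_all

text \<open>
  The witness \<open>(x, y)\<close> is the lowest position in the leftmost occupied column: with nothing to its left
  or below it, its tile must continue upwards and to the right. The tile to the right ensures that the
  leftmost column is not also the rightmost one.
\<close>

lemma leftmost_column:
  assumes "mosaic n M" "non_blank_positions n M \<noteq> {}"
  obtains x y y' where "(x, y) \<in> non_blank_positions n M" "(x, Suc y) \<in> non_blank_positions n M"
    "(Suc x, y') \<in> non_blank_positions n M"
proof -
  let ?S = "non_blank_positions n M"
  define x where "x = (LEAST x. \<exists>y. (x, y) \<in> ?S)"
  define y where "y = (LEAST y. (x, y) \<in> ?S)"
  have "\<exists>x y. (x, y) \<in> ?S" using assms(2) by auto
  then have "\<exists>y. (x, y) \<in> ?S" unfolding x_def by (rule LeastI_ex)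
  then have mem: "(x, y) \<in> ?S" unfolding y_def by (rule LeastI_ex)
  have x_min: "x \<le> a" if "(a, b) \<in> ?S" for a b
    unfolding x_def using that by (blast intro: Least_le)
  have y_min: "y \<le> b" if "(x, b) \<in> ?S" for b
    unfolding y_def using that by (rule Least_le)
  note neighbour = non_blank_neighbour[OF assms(1) mem]
  have "Left \<notin> connection_points (M x y)"
    by (rule notI, erule neighbour) (use x_min in fastforce)
  moreover have "Bottom \<notin> connection_points (M x y)"
    by (rule notI, erule neighbour) (use y_min in fastforce)
  moreover have "M x y \<noteq> T0" using mem by (simp add: non_blank_positions_def)
  ultimately have top: "Top \<in> connection_points (M x y)" and right: "Right \<in> connection_points (M x y)"
    using top_right_if_not_left_bottom by blast+
  from top have "(x, Suc y) \<in> ?S" by (rule neighbour) simp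
  moreover from right have "(Suc x, y) \<in> ?S" by (rule neighbour) simp
  ultimately show thesis using mem that by blast
qed

text \<open>Dually, the highest tile of the rightmost occupied column must continue downwards.\<close>

lemma rightmost_column:
  assumes "mosaic n M" "non_blank_positions n M \<noteq> {}"
  obtains x y where "(x, y) \<in> non_blank_positions n M" "(x, Suc y) \<in> non_blank_positions n M"
    "\<And>a b. (a, b) \<in> non_blank_positions n M \<Longrightarrow> a \<le> x"
proof -
  let ?S = "non_blank_positions n M"
  have bounds: "a \<le> n" "b \<le> n" if "(a, b) \<in> ?S" for a b
    using that by (auto simp: non_blank_positions_def)
  define x where "x = (GREATEST x. \<exists>y. (x, y) \<in> ?S)"
  define y where "y = (GREATEST y. (x, y) \<in> ?S)"
  have "\<exists>x y. (x, y) \<in> ?S" using assms(2) by auto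
  then have "\<exists>y. (x, y) \<in> ?S" unfolding x_def by (rule GreatestI_ex_nat) (use bounds in blast)
  then have mem: "(x, y) \<in> ?S" unfolding y_def by (rule GreatestI_ex_nat) (use bounds in blast)
  have x_max: "a \<le> x" if "(a, b) \<in> ?S" for a b
    unfolding x_def by (rule Greatest_le_nat[where b = n]) (use that bounds in blast)+
  have y_max: "b \<le> y" if "(x, b) \<in> ?S" for b
    unfolding y_def by (rule Greatest_le_nat[where b = n]) (use that bounds in blast)+
  note neighbour = non_blank_neighbour[OF assms(1) mem]
  have "Right \<notin> connection_points (M x y)"
    by (rule notI, erule neighbour) (use x_max in fastforce)
  moreover have "Top \<notin> connection_points (M x y)"
    by (rule notI, erule neighbour) (use y_max in fastforce)
  moreover have "M x y \<noteq> T0" using mem by (simp add: non_blank_positions_def)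
  ultimately have "Bottom \<in> connection_points (M x y)"
    using bottom_if_not_right_top by blast
  then obtain b where "(x, b) \<in> ?S" "y = Suc b" by (rule neighbour) auto
  then show thesis using mem x_max that by blast
qed

lemma four_le_mosaic_tile_number:
  assumes "mosaic n M" "non_blank_positions n M \<noteq> {}"
  shows "4 \<le> mosaic_tile_number n M"
proof -
  let ?S = "non_blank_positions n M"
  obtain x y y' where left: "(x, y) \<in> ?S" "(x, Suc y) \<in> ?S" and "(Suc x, y') \<in> ?S"
    using leftmost_column[OF assms] .
  moreover obtain u v where right: "(u, v) \<in> ?S" "(u, Suc v) \<in> ?S" and "\<And>a b. (a, b) \<in> ?S \<Longrightarrow> a \<le> u"
    using rightmost_column[OF assms] by blast
  ultimately have "x < u" by fastforce
  then have "card {(x, y), (x, Suc y), (u, v), (u, Suc v)} = 4" by simp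
  moreover have "card {(x, y), (x, Suc y), (u, v), (u, Suc v)} \<le> card ?S"
    by (rule card_mono[OF finite_non_blank_positions]) (use left right in auto)
  ultimately show ?thesis by (simp add: mosaic_tile_number_eq_card)
qed

section \<open>Ambient isotopy\<close>

text \<open>Performing both isotopies at the same time avoids having to concatenate them.\<close>

lemma ambient_isotopic_trans:
  assumes "ambient_isotopic A B" "ambient_isotopic B C"
  shows "ambient_isotopic A C"
proof -
  obtain F :: "real \<Rightarrow> real^3 \<Rightarrow> real^3" where
    contF: "continuous_on ({0..1} \<times> UNIV) (\<lambda>(t, p). F t p)"
    and homF: "\<forall>t \<in> {0..1}. \<exists>F'. homeomorphism UNIV UNIV (F t) F'"
    and F: "\<forall>p. F 0 p = p" "F 1 ` A = B"
    using assms(1) unfolding ambient_isotopic_def by blast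
  obtain G :: "real \<Rightarrow> real^3 \<Rightarrow> real^3" where
    contG: "continuous_on ({0..1} \<times> UNIV) (\<lambda>(t, p). G t p)"
    and homG: "\<forall>t \<in> {0..1}. \<exists>G'. homeomorphism UNIV UNIV (G t) G'"
    and G: "\<forall>p. G 0 p = p" "G 1 ` B = C"
    using assms(2) unfolding ambient_isotopic_def by blast
  have "continuous_on ({0..1} \<times> UNIV) (\<lambda>q. (fst q, F (fst q) (snd q)))"
    using contF by (intro continuous_intros) (simp_all add: case_prod_unfold)
  then have "continuous_on ({0..1} \<times> UNIV) (\<lambda>q. (\<lambda>(t, p). G t p) (fst q, F (fst q) (snd q)))"
    by (rule continuous_on_compose2[OF contG]) auto
  then have "continuous_on ({0..1} \<times> UNIV) (\<lambda>(t, p). G t (F t p))"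
    by (simp add: case_prod_unfold)
  moreover have "\<exists>H'. homeomorphism UNIV UNIV (\<lambda>p. G t (F t p)) H'" if "t \<in> {0..1}" for t
    using homeomorphism_compose[of UNIV UNIV "F t" _ UNIV "G t"] homF homG that
    unfolding comp_def by blast
  moreover have "(\<lambda>p. G 1 (F 1 p)) ` A = C"
    using F(2) G(2) by (simp flip: image_image)
  ultimately show ?thesis
    unfolding ambient_isotopic_def using F(1) G(1)
    by (intro exI[of _ "\<lambda>t p. G t (F t p)"]) simp
qed

lemma ambient_isotopic_homothety:
  fixes c :: "real^3"
  assumes "0 < r"
  shows "ambient_isotopic A ((\<lambda>p. r *\<^sub>R (p - c)) ` A)"
proof -
  \<comment> \<open>The straight line from the identity to the homothety; its scaling factor never vanishes.\<close>
  define a where "a t = 1 - t + t * r" for t :: real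
  define H where "H t p = a t *\<^sub>R p - (t * r) *\<^sub>R c" for t p
  have pos: "0 < a t" if "t \<in> {0..1}" for t
  proof (cases "t = 0")
    case False
    then have "0 < t * r" "0 \<le> 1 - t" using that assms by auto
    then show ?thesis by (simp add: a_def)
  qed (simp add: a_def)
  have "continuous_on ({0..1} \<times> UNIV) (\<lambda>(t, p). H t p)"
    unfolding H_def a_def case_prod_unfold by (intro continuous_intros)
  moreover have "\<exists>G. homeomorphism UNIV UNIV (H t) G" if "t \<in> {0..1}" for t
  proof
    show "homeomorphism UNIV UNIV (H t) (\<lambda>p. (1 / a t) *\<^sub>R (p + (t * r) *\<^sub>R c))"
      unfolding H_def by (rule homeomorphismI) (use pos[OF that] in \<open>auto intro!: continuous_intros\<close>)
  qed
  moreover have "H 0 p = p" for p by (simp add: H_def a_def)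
  moreover have "H 1 = (\<lambda>p. r *\<^sub>R (p - c))" by (simp add: H_def a_def fun_eq_iff scaleR_diff_right)
  ultimately show ?thesis unfolding ambient_isotopic_def by (intro exI[of _ H]) simp
qed

section \<open>Four arc tiles draw an unknot\<close>

definition four_arcs :: "nat \<Rightarrow> nat \<Rightarrow> tile" where
  "four_arcs x y = (if x = 0 then if y = 0 then T3 else T2 else if y = 0 then T4 else T1)"

lemma mosaic_four_arcs: "mosaic 2 four_arcs"
proof -
  have all: "(\<forall>i < 2. P i) \<longleftrightarrow> P 0 \<and> P 1" for P :: "nat \<Rightarrow> bool"
    by (auto simp: less_2_cases_iff)
  have ex: "(\<exists>i < 2. P i) \<longleftrightarrow> P 0 \<or> P 1" for P :: "nat \<Rightarrow> bool"
    by (auto simp: less_2_cases_iff)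
  show ?thesis by (simp add: mosaic_def suitably_connected_def four_arcs_def all ex)
qed

lemma mosaic_tile_number_four_arcs: "mosaic_tile_number 2 four_arcs = 4"
proof -
  have "non_blank_positions 2 four_arcs = {..<2} \<times> {..<2}"
    by (auto simp: non_blank_positions_def four_arcs_def)
  then show ?thesis by (simp add: mosaic_tile_number_eq_card)
qed

lemma vector_3_add: "vector [a, b, c] + vector [u, v, w] = (vector [a + u, b + v, c + w] :: real^3)"
  by (simp add: vec_eq_iff forall_3)

lemma ex_vector_3: obtains u v w where "(p :: real^3) = vector [u, v, w]"
  by (rule that[of "p $ 1" "p $ 2" "p $ 3"]) (simp add: vec_eq_iff forall_3)

lemma mem_translate_quarter_circle:
  "vector [u, v, w] \<in> (\<lambda>p. vector [x, y, 0] + p) ` quarter_circle a b \<longleftrightarrow>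
     x \<le> u \<and> u \<le> x + 1 \<and> y \<le> v \<and> v \<le> y + 1 \<and> w = 0 \<and>
     (u - x - a)\<^sup>2 + (v - y - b)\<^sup>2 = (1/2)\<^sup>2"
proof -
  have "vector [u, v, w] \<in> (\<lambda>p. vector [x, y, 0] + p) ` quarter_circle a b \<longleftrightarrow>
      (vector [u - x, v - y, w] :: real^3) \<in> quarter_circle a b"
  proof
    assume "(vector [u - x, v - y, w] :: real^3) \<in> quarter_circle a b"
    then show "vector [u, v, w] \<in> (\<lambda>p. vector [x, y, 0] + p) ` quarter_circle a b"
      by (rule rev_image_eqI) (simp add: vector_3_add)
  next
    assume "vector [u, v, w] \<in> (\<lambda>p. vector [x, y, 0] + p) ` quarter_circle a b"
    then obtain p where p: "p \<in> quarter_circle a b" "vector [u, v, w] = vector [x, y, 0] + p"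
      by blast
    then have "p = vector [u - x, v - y, w]" by (auto simp: vec_eq_iff forall_3)
    with p(1) show "(vector [u - x, v - y, w] :: real^3) \<in> quarter_circle a b" by simp
  qed
  then show ?thesis by (auto simp: mem_quarter_circle)
qed

lemma mem_mosaic_link_four_arcs:
  "vector [u, v, w] \<in> mosaic_link 2 four_arcs \<longleftrightarrow> w = 0 \<and> (u - 1)\<^sup>2 + (v - 1)\<^sup>2 = (1/2)\<^sup>2"
proof -
  have "{..<2::nat} = {0, 1}" by auto
  then have link: "vector [u, v, w] \<in> mosaic_link 2 four_arcs \<longleftrightarrow>
      w = 0 \<and> (u - 1)\<^sup>2 + (v - 1)\<^sup>2 = (1/2)\<^sup>2 \<and> 0 \<le> u \<and> u \<le> 2 \<and> 0 \<le> v \<and> v \<le> 2"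
    by (simp add: mosaic_link_def four_arcs_def mem_translate_quarter_circle) argo
  \<comment> \<open>The circle stays inside the array, so cutting it along the edges of the tiles loses no point.\<close>
  have "0 \<le> u \<and> u \<le> 2 \<and> 0 \<le> v \<and> v \<le> 2" if "(u - 1)\<^sup>2 + (v - 1)\<^sup>2 = (1/2)\<^sup>2"
  proof -
    have "(u - 1)\<^sup>2 \<le> (1/2)\<^sup>2" "(v - 1)\<^sup>2 \<le> (1/2)\<^sup>2"
      using that zero_le_power2[of "u - 1"] zero_le_power2[of "v - 1"] by linarith+
    then have "\<bar>u - 1\<bar> \<le> \<bar>1/2\<bar>" "\<bar>v - 1\<bar> \<le> \<bar>1/2\<bar>" by (simp_all only: abs_le_square_iff)
    then show ?thesis by linarith
  qed
  with link show ?thesis by blast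
qed

lemma mem_standard_circle: "vector [u, v, w] \<in> standard_circle \<longleftrightarrow> w = 0 \<and> u\<^sup>2 + v\<^sup>2 = 1"
proof
  assume "vector [u, v, w] \<in> standard_circle"
  then show "w = 0 \<and> u\<^sup>2 + v\<^sup>2 = 1" by (auto simp: standard_circle_def vec_eq_iff forall_3)
next
  assume "w = 0 \<and> u\<^sup>2 + v\<^sup>2 = 1"
  moreover from this obtain t where "u = cos t" "v = sin t" using sincos_total_2pi by blast
  ultimately show "vector [u, v, w] \<in> standard_circle" by (auto simp: standard_circle_def)
qed

lemma four_arcs_isotopic_standard_circle: "ambient_isotopic (mosaic_link 2 four_arcs) standard_circle"
proof -
  let ?f = "\<lambda>p :: real^3. 2 *\<^sub>R (p - vector [1, 1, 0])"
  have f: "?f (vector [u, v, w]) = vector [2 * (u - 1), 2 * (v - 1), 2 * w]" for u v w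
    by (simp add: vec_eq_iff forall_3)
  have "?f ` mosaic_link 2 four_arcs = standard_circle"
  proof (intro equalityI subsetI)
    fix q assume "q \<in> ?f ` mosaic_link 2 four_arcs"
    then obtain p where p: "p \<in> mosaic_link 2 four_arcs" "q = ?f p" by blast
    obtain u v w where uvw: "p = vector [u, v, w]" by (rule ex_vector_3)
    with p(1) have "w = 0" "(u - 1)\<^sup>2 + (v - 1)\<^sup>2 = (1/2)\<^sup>2"
      by (simp_all add: mem_mosaic_link_four_arcs)
    then have "2 * w = 0 \<and> (2 * (u - 1))\<^sup>2 + (2 * (v - 1))\<^sup>2 = 1"
      by (simp only: power_mult_distrib) (simp add: power_divide)
    then show "q \<in> standard_circle" unfolding p(2) uvw f mem_standard_circle .
  next
    fix q assume q: "q \<in> standard_circle"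
    obtain u v w where uvw: "q = vector [u, v, w]" by (rule ex_vector_3)
    with q have "w = 0" "u\<^sup>2 + v\<^sup>2 = 1" by (simp_all add: mem_standard_circle)
    then have "(vector [1 + u / 2, 1 + v / 2, 0] :: real^3) \<in> mosaic_link 2 four_arcs"
      by (simp add: mem_mosaic_link_four_arcs power_divide flip: add_divide_distrib)
    moreover have "q = ?f (vector [1 + u / 2, 1 + v / 2, 0])" unfolding f uvw \<open>w = 0\<close> by simp
    ultimately show "q \<in> ?f ` mosaic_link 2 four_arcs" by (rule rev_image_eqI)
  qed
  moreover have "ambient_isotopic (mosaic_link 2 four_arcs) (?f ` mosaic_link 2 four_arcs)"
    by (rule ambient_isotopic_homothety) simp
  ultimately show ?thesis by simp
qed

section \<open>The tile numbers of the unknot\<close>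

lemma non_blank_positions_if_represents:
  assumes "represents n M K" "K \<noteq> {}"
  shows "non_blank_positions n M \<noteq> {}"
proof
  assume "non_blank_positions n M = {}"
  then have "\<forall>x < n. \<forall>y < n. M x y = T0" by (auto simp: non_blank_positions_def)
  then have "mosaic_link n M = {}" by (auto simp: mosaic_link_def)
  then show False using assms by (auto simp: represents_def ambient_isotopic_def)
qed

theorem theorem10:
  fixes K :: "(real^3) set"
  assumes "is_unknot K"
  shows "tile_number K = 4 \<and> minimal_mosaic_tile_number K = 4"
proof -
  have rep: "represents 2 four_arcs K"
    using ambient_isotopic_trans[OF four_arcs_isotopic_standard_circle] assms mosaic_four_arcs
    by (simp add: represents_def is_unknot_def)
  have "K \<noteq> {}"
    using assms by (auto simp: is_unknot_def ambient_isotopic_def standard_circle_def)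
  then have lower: "4 \<le> mosaic_tile_number n M" if "represents n M K" for n M
    using four_le_mosaic_tile_number[OF _ non_blank_positions_if_represents[OF that]] that
    by (simp add: represents_def)
  have "tile_number K = 4"
    unfolding tile_number_def
    by (rule Least_equality) (use rep lower mosaic_tile_number_four_arcs in auto)
  moreover have "mosaic_number K = 2"
    unfolding mosaic_number_def
  proof (rule Least_equality)
    fix n assume "\<exists>M. represents n M K"
    then obtain M where "represents n M K" by blast
    then have "2 * 2 \<le> n * n" using lower[of n M] mosaic_tile_number_le_square[of n M] by linarith
    then show "2 \<le> n" by (metis linorder_not_less mult_strict_mono' zero_le)
  qed (use rep in blast)
  then have "minimal_mosaic_tile_number K = 4"
    unfolding minimal_mosaic_tile_number_def
    by (intro Least_equality) (use rep lower mosaic_tile_number_four_arcs in auto)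
  ultimately show ?thesis ..
qed

end
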